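(* Let $R$ be a valuation subsemiring of a unitgenerated idempotent semiring $K$. Let $\Gamma=K^\times/R^\times$, totally ordered by $[x]\leq[y]\iff xy^{-1}\in R$, where $[u]$ is the class of $u\in K^\times$. Let $v:K\rightarrow \Gamma_{\max}$ be the (well-defined) map given by $v\left(\sum_{i\in I} x_i\right)=\sum_{i\in I}[x_i]$ for any finite set $I$ and any units $x_i\in K^\times$. Then $R=\{x\in K\mid v(x)\leq 1\}$.
   Context: Semirings are commutative with $0\neq 1$. A semiring is idempotent if $x+x=x$ for all $x$; it then carries the canonical partial order $x\leq y\iff x+y=y$. For a totally ordered abelian group $\Gamma$ (written multiplicatively), $\Gamma_{\max}=\Gamma\cup\{0\}$ is the idempotent semifield with $x+y=\max(x,y)$ and multiplication from $\Gamma$, with $0$ least and absorbing. $K^\times$ denotes the group of units of $K$. An idempotent semiring $K$ is unitgenerated if every element is a finite sum of units (the empty sum being $0$). A subsemiring $R\subseteq K$ is saturated if $x\leq y$ and $y\in R$ imply $x\in R$. A valuation subsemiring of $K$ is a saturated subsemiring $R\subseteq K$ such that for every $x\in K^\times$, either $x\in R$ or $x^{-1}\in R$. *)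

theory Defs
  imports "HOL-Algebra.Coset" "HOL-Algebra.Ring"
begin

locale comm_semiring = semiring R + comm_monoid R for R (structure) +
  assumes zero_not_one: "\<zero> \<noteq> \<one>"

locale idempotent_semiring = comm_semiring +
  assumes add_idem: "x \<in> carrier R \<Longrightarrow> x \<oplus> x = x"

definition canonical_le :: "('a, 'm) ring_scheme \<Rightarrow> 'a \<Rightarrow> 'a \<Rightarrow> bool" where
  "canonical_le K x y \<longleftrightarrow> x \<oplus>\<^bsub>K\<^esub> y = y"

text \<open>Every finite family can be indexed by a finite set of natural numbers, and the empty
  \<^const>\<open>finsum\<close> is zero.\<close>

definition unitgenerated :: "('a, 'm) ring_scheme \<Rightarrow> bool" where
  "unitgenerated K \<longleftrightarrow>
    (\<forall>x\<in>carrier K. \<exists>(I :: nat set) a. finite I \<and> a \<in> I \<rightarrow> Units K \<and> x = finsum K a I)"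

locale subsemiring =
  fixes R and K (structure)
  assumes subset: "R \<subseteq> carrier K"
    and zero_mem: "\<zero> \<in> R"
    and one_mem: "\<one> \<in> R"
    and add_mem: "\<lbrakk>x \<in> R; y \<in> R\<rbrakk> \<Longrightarrow> x \<oplus> y \<in> R"
    and mult_mem: "\<lbrakk>x \<in> R; y \<in> R\<rbrakk> \<Longrightarrow> x \<otimes> y \<in> R"

locale valuation_subsemiring = subsemiring +
  assumes saturated: "\<lbrakk>x \<in> carrier K; y \<in> R; canonical_le K x y\<rbrakk> \<Longrightarrow> x \<in> R"
    and unit_or_inv: "x \<in> Units K \<Longrightarrow> x \<in> R \<or> inv x \<in> R"

locale totally_ordered_comm_group = comm_group G for G (structure) +
  fixes r :: "('a \<times> 'a) set"
  assumes linear: "linear_order_on (carrier G) r"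
    and mult_right_mono: "\<lbrakk>(x, y) \<in> r; z \<in> carrier G\<rbrakk> \<Longrightarrow> (x \<otimes> z, y \<otimes> z) \<in> r"

text \<open>The adjoined zero is \<^const>\<open>None\<close>.\<close>

definition max_semifield :: "('g, 'm) monoid_scheme \<Rightarrow> ('g \<times> 'g) set \<Rightarrow> 'g option ring" where
  "max_semifield G r =
    \<lparr>carrier = insert None (Some ` carrier G),
     mult = (\<lambda>a b. case (a, b) of (Some x, Some y) \<Rightarrow> Some (x \<otimes>\<^bsub>G\<^esub> y) | _ \<Rightarrow> None),
     one = Some \<one>\<^bsub>G\<^esub>,
     zero = None,
     add = (\<lambda>a b. case (a, b) of
                (None, _) \<Rightarrow> b
              | (_, None) \<Rightarrow> a
              | (Some x, Some y) \<Rightarrow> Some (if (x, y) \<in> r then y else x))\<rparr>"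

definition sub_units :: "('a, 'm) ring_scheme \<Rightarrow> 'a set \<Rightarrow> 'a set" where
  "sub_units K R = Units (K\<lparr>carrier := R\<rparr>)"

definition value_group :: "('a, 'm) ring_scheme \<Rightarrow> 'a set \<Rightarrow> 'a set monoid" where
  "value_group K R = units_of K Mod sub_units K R"

definition unit_class :: "('a, 'm) ring_scheme \<Rightarrow> 'a set \<Rightarrow> 'a \<Rightarrow> 'a set" where
  "unit_class K R u = sub_units K R #>\<^bsub>units_of K\<^esub> u"

definition value_le :: "('a, 'm) ring_scheme \<Rightarrow> 'a set \<Rightarrow> ('a set \<times> 'a set) set" where
  "value_le K R = {(unit_class K R x, unit_class K R y) | x y.
     x \<in> Units K \<and> y \<in> Units K \<and> x \<otimes>\<^bsub>K\<^esub> inv\<^bsub>K\<^esub> y \<in> R}"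

definition value_semifield :: "('a, 'm) ring_scheme \<Rightarrow> 'a set \<Rightarrow> 'a set option ring" where
  "value_semifield K R = max_semifield (value_group K R) (value_le K R)"

text \<open>The description is meaningful only when the value does not depend on the chosen
  presentation of \<open>x\<close> as a sum of units; the result is unspecified if there is none.\<close>

definition valuation_map :: "('a, 'm) ring_scheme \<Rightarrow> 'a set \<Rightarrow> 'a \<Rightarrow> 'a set option" where
  "valuation_map K R x = (THE g. \<exists>(I :: nat set) a. finite I \<and> a \<in> I \<rightarrow> Units K \<and>
     x = finsum K a I \<and> g = (\<Oplus>\<^bsub>value_semifield K R\<^esub>i\<in>I. Some (unit_class K R (a i))))"

end

(* For a finite sum s of units x_i, saturation shows that s u^-1 lies in R iff every x_i u^-1 does,
   that is, iff the maximum of the classes [x_i] is at most [u]. Moreover s = 0 only for the empty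
   sum, because a unit below 0 would be 0. Hence the maximum depends only on s, which makes v
   well defined, and u = 1 gives the description of R. *)

theory Submission
  imports Defs
begin

section \<open>Addition and order in the max semifield of a totally ordered group\<close>

lemma max_semifield_simps [simp]:
  "carrier (max_semifield G r) = insert None (Some ` carrier G)"
  "\<zero>\<^bsub>max_semifield G r\<^esub> = None"
  "\<one>\<^bsub>max_semifield G r\<^esub> = Some \<one>\<^bsub>G\<^esub>"
  "None \<oplus>\<^bsub>max_semifield G r\<^esub> b = b"
  "a \<oplus>\<^bsub>max_semifield G r\<^esub> None = a"
  "Some x \<oplus>\<^bsub>max_semifield G r\<^esub> Some y = Some (if (x, y) \<in> r then y else x)"
  by (auto simp: max_semifield_def split: option.split)

lemma (in totally_ordered_comm_group)
  shows order_refl: "x \<in> carrier G \<Longrightarrow> (x, x) \<in> r"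
    and order_trans: "(x, y) \<in> r \<Longrightarrow> (y, z) \<in> r \<Longrightarrow> (x, z) \<in> r"
    and order_antisym: "(x, y) \<in> r \<Longrightarrow> (y, x) \<in> r \<Longrightarrow> x = y"
    and order_total: "x \<in> carrier G \<Longrightarrow> y \<in> carrier G \<Longrightarrow> (x, y) \<in> r \<or> (y, x) \<in> r"
proof -
  have r: "refl_on (carrier G) r" "trans r" "antisym r" "total_on (carrier G) r"
    using linear by (auto simp: linear_order_on_def partial_order_on_def preorder_on_def)
  show refl: "(x, x) \<in> r" if "x \<in> carrier G" for x
    using r(1) that by (rule refl_onD)
  show "(x, z) \<in> r" if "(x, y) \<in> r" "(y, z) \<in> r" for x y z
    using r(2) that by (rule transD)
  show "x = y" if "(x, y) \<in> r" "(y, x) \<in> r" for x y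
    using r(3) that by (rule antisymD)
  show "(x, y) \<in> r \<or> (y, x) \<in> r" if "x \<in> carrier G" "y \<in> carrier G" for x y
    using r(4) refl that by (cases "x = y") (auto simp: total_on_def)
qed

lemma (in totally_ordered_comm_group) abelian_monoid_max_semifield:
  "abelian_monoid (max_semifield G r)"
proof (rule abelian_monoidI)
  let ?S = "max_semifield G r"
  fix a b c
  assume a: "a \<in> carrier ?S" and b: "b \<in> carrier ?S"
  then show "a \<oplus>\<^bsub>?S\<^esub> b \<in> carrier ?S" by auto
  show "a \<oplus>\<^bsub>?S\<^esub> b = b \<oplus>\<^bsub>?S\<^esub> a"
    using a b order_antisym order_total by (cases a; cases b) auto
  assume c: "c \<in> carrier ?S"
  show "a \<oplus>\<^bsub>?S\<^esub> b \<oplus>\<^bsub>?S\<^esub> c = a \<oplus>\<^bsub>?S\<^esub> (b \<oplus>\<^bsub>?S\<^esub> c)"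
  proof (cases "a = None \<or> b = None \<or> c = None")
    case False
    with a b c obtain x y z where "a = Some x" "b = Some y" "c = Some z"
      "x \<in> carrier G" "y \<in> carrier G" "z \<in> carrier G"
      by auto
    \<comment> \<open>Two cases need an argument. If x \<le> y \<le> z, transitivity through
      \<open>y\<close> gives x \<le> z. If y < x and z < y, then x \<le> z would give x \<le> y
      through \<open>z\<close>.\<close>
    then show ?thesis
      using order_trans[of x y z] order_trans[of x z y] order_total[of y z]
        order_antisym[of y z] by auto
  qed auto
qed auto

text \<open>Addition is the maximum, hence a join for the canonical order. This lets an upper bound
  of a finite sum be tested on each summand.\<close>

lemma (in totally_ordered_comm_group) max_semifield_add_le_iff:
  assumes "a \<in> carrier (max_semifield G r)" "b \<in> carrier (max_semifield G r)" "g \<in> carrier G"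
  shows "canonical_le (max_semifield G r) (a \<oplus>\<^bsub>max_semifield G r\<^esub> b) (Some g)
    \<longleftrightarrow> canonical_le (max_semifield G r) a (Some g) \<and> canonical_le (max_semifield G r) b (Some g)"
proof (cases "a = None \<or> b = None")
  case True
  then show ?thesis by (auto simp: canonical_le_def)
next
  case False
  with assms obtain x y where "a = Some x" "b = Some y" "x \<in> carrier G" "y \<in> carrier G"
    by auto
  then show ?thesis
    using assms(3) order_trans[of x y g] order_trans[of y x g] order_total[of x y]
      order_refl[of g]
    by (auto simp: canonical_le_def)
qed

section \<open>Zero and units in idempotent semirings\<close>

lemma (in idempotent_semiring) le_add:
  assumes "x \<in> carrier R" "y \<in> carrier R"
  shows "canonical_le R x (x \<oplus> y)"
  using assms by (simp add: canonical_le_def add_idem flip: a_assoc)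

text \<open>Each summand lies below the sum, and only zero lies below zero.\<close>

lemma (in idempotent_semiring) add_eq_zero_iff:
  assumes "x \<in> carrier R" "y \<in> carrier R"
  shows "x \<oplus> y = \<zero> \<longleftrightarrow> x = \<zero> \<and> y = \<zero>"
  using assms le_add[of x y] le_add[of y x] by (auto simp: canonical_le_def a_comm)

lemma (in comm_semiring) Units_nonzero: "x \<in> Units R \<Longrightarrow> x \<noteq> \<zero>"
  using zero_not_one by (auto simp: Units_def)

lemma (in comm_monoid) inv_mult_Units:
  assumes "x \<in> Units G" "y \<in> Units G"
  shows "inv (x \<otimes> y) = inv y \<otimes> inv x"
  using group.inv_mult_group[OF units_group, of x y] assms
  by (simp add: units_of_carrier units_of_mult units_of_inv)

section \<open>Units of a valuation subsemiring and the quotient group\<close>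

locale valued_semiring = idempotent_semiring K + valuation_subsemiring R K
  for K (structure) and R
begin

abbreviation "\<Gamma> \<equiv> value_group K R"
abbreviation "cls \<equiv> unit_class K R"
abbreviation "V \<equiv> value_semifield K R"

text \<open>Each summand lies below the sum, so saturation pulls it into \<open>R\<close>; the
  converse is closure under addition. Saturation enters the argument only here.\<close>

lemma add_mem_iff:
  assumes "x \<in> carrier K" "y \<in> carrier K"
  shows "x \<oplus> y \<in> R \<longleftrightarrow> x \<in> R \<and> y \<in> R"
  using assms le_add[of x y] le_add[of y x] saturated[of x "x \<oplus> y"] saturated[of y "x \<oplus> y"] add_mem
  by (auto simp: a_comm)

lemma mem_sub_units_iff: "x \<in> sub_units K R \<longleftrightarrow> x \<in> Units K \<and> x \<in> R \<and> inv x \<in> R"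
proof
  assume "x \<in> sub_units K R"
  then obtain y where y: "x \<in> R" "y \<in> R" "y \<otimes> x = \<one>" "x \<otimes> y = \<one>"
    by (auto simp: sub_units_def Units_def)
  \<comment> \<open>An inverse taken inside \<open>R\<close> is also an inverse in \<open>K\<close>,
    so uniqueness identifies it with \<open>inv x\<close>.\<close>
  then have "y = inv x" using subset by (intro inv_unique') auto
  with y subset show "x \<in> Units K \<and> x \<in> R \<and> inv x \<in> R" by (auto simp: Units_def)
next
  assume x: "x \<in> Units K \<and> x \<in> R \<and> inv x \<in> R"
  then have "inv x \<otimes> x = \<one>" "x \<otimes> inv x = \<one>" by simp_all
  with x show "x \<in> sub_units K R" unfolding sub_units_def Units_def by auto
qed

lemma unit_group: "comm_group (units_of K)"
  by (rule units_comm_group)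

lemma sub_units_subgroup: "subgroup (sub_units K R) (units_of K)"
proof (rule group.subgroupI)
  show "group (units_of K)" by (rule units_group)
  show "sub_units K R \<subseteq> carrier (units_of K)"
    by (auto simp: mem_sub_units_iff units_of_carrier)
  show "sub_units K R \<noteq> {}"
    using one_mem mem_sub_units_iff[of \<one>] by auto
qed (auto simp: mem_sub_units_iff units_of_inv units_of_mult mult_mem inv_mult_Units)

lemma sub_units_normal: "sub_units K R \<lhd> units_of K"
  using sub_units_subgroup unit_group by (rule comm_group.normal_iff_subgroup[THEN iffD2, rotated])

lemma comm_group_value_group: "comm_group \<Gamma>"
  unfolding value_group_def
  using sub_units_subgroup unit_group comm_group.abelian_FactGroup by blast

lemma carrier_value_group: "carrier \<Gamma> = cls ` Units K"
  by (auto simp: value_group_def FactGroup_def RCOSETS_def unit_class_def units_of_carrier)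

lemma cls_closed [simp]: "u \<in> Units K \<Longrightarrow> cls u \<in> carrier \<Gamma>"
  by (simp add: carrier_value_group)

lemma cls_mult: "x \<in> Units K \<Longrightarrow> y \<in> Units K \<Longrightarrow> cls x \<otimes>\<^bsub>\<Gamma>\<^esub> cls y = cls (x \<otimes> y)"
  using normal.rcos_sum[OF sub_units_normal, of x y]
  by (simp add: value_group_def FactGroup_def unit_class_def units_of_carrier units_of_mult)

lemma cls_one: "cls \<one> = \<one>\<^bsub>\<Gamma>\<^esub>"
  using group.coset_mult_one[OF units_group subgroup.subset[OF sub_units_subgroup]]
  by (simp add: value_group_def FactGroup_def unit_class_def units_of_one)

text \<open>Cosets agree when the quotient of their representatives is a unit of \<open>R\<close>,
  and \<open>y \<otimes> inv x\<close> is the inverse of \<open>x \<otimes> inv y\<close>. In terms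
  of the order this is antisymmetry.\<close>

lemma cls_eq_iff:
  assumes "x \<in> Units K" "y \<in> Units K"
  shows "cls x = cls y \<longleftrightarrow> x \<otimes> inv y \<in> R \<and> y \<otimes> inv x \<in> R"
proof -
  have "cls x = cls y \<longleftrightarrow> x \<in> cls y"
    unfolding unit_class_def
    using assms group.repr_independence[OF units_group _ _ sub_units_subgroup, of x y]
      group.rcos_self[OF units_group _ sub_units_subgroup, of x]
    by (auto simp: units_of_carrier)
  also have "\<dots> \<longleftrightarrow> x \<otimes> inv y \<in> sub_units K R"
    unfolding unit_class_def
    using assms subgroup.rcos_module[OF sub_units_subgroup units_group, of y x]
    by (simp add: units_of_carrier units_of_inv units_of_mult)
  also have "\<dots> \<longleftrightarrow> x \<otimes> inv y \<in> R \<and> y \<otimes> inv x \<in> R"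
    using assms by (auto simp: mem_sub_units_iff inv_mult_Units)
  finally show ?thesis .
qed

section \<open>The order on the value group\<close>

lemma quotient_mult:
  assumes "x \<in> Units K" "y \<in> Units K" "z \<in> Units K"
  shows "(x \<otimes> inv y) \<otimes> (y \<otimes> inv z) = x \<otimes> inv z"
proof -
  have "(x \<otimes> inv y) \<otimes> (y \<otimes> inv z) = x \<otimes> (inv y \<otimes> y) \<otimes> inv z"
    using assms by (simp add: m_assoc Units_closed del: Units_l_inv Units_r_inv)
  then show ?thesis using assms by (simp add: Units_closed)
qed

text \<open>The product of the two given quotients telescopes through \<open>y\<close>, and
  \<open>R\<close> is closed under products.\<close>

lemma quotient_mem_trans:
  assumes "x \<in> Units K" "y \<in> Units K" "z \<in> Units K" "x \<otimes> inv y \<in> R" "y \<otimes> inv z \<in> R"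
  shows "x \<otimes> inv z \<in> R"
  using assms mult_mem[of "x \<otimes> inv y" "y \<otimes> inv z"] by (simp add: quotient_mult)

text \<open>The valuation axiom applied to a quotient of units; it becomes totality of the
  order.\<close>

lemma quotient_total:
  assumes "x \<in> Units K" "y \<in> Units K"
  shows "x \<otimes> inv y \<in> R \<or> y \<otimes> inv x \<in> R"
  using assms unit_or_inv[of "x \<otimes> inv y"] by (simp add: inv_mult_Units)

text \<open>\<open>value_le\<close> asks only for some pair of representatives, so independence of
  the choice has to be proved. Changing a representative multiplies by a quotient of equivalent
  units, which lies in \<open>R\<close>: the chain is x, x', y', y.\<close>

lemma cls_le_iff:
  assumes "x \<in> Units K" "y \<in> Units K"
  shows "(cls x, cls y) \<in> value_le K R \<longleftrightarrow> x \<otimes> inv y \<in> R"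
proof
  assume "(cls x, cls y) \<in> value_le K R"
  then obtain x' y' where *: "cls x = cls x'" "cls y = cls y'" "x' \<in> Units K" "y' \<in> Units K"
    "x' \<otimes> inv y' \<in> R"
    by (auto simp: value_le_def)
  then have "x \<otimes> inv x' \<in> R" "y' \<otimes> inv y \<in> R"
    using assms cls_eq_iff by blast+
  with * assms show "x \<otimes> inv y \<in> R" using quotient_mem_trans by metis
qed (use assms in \<open>auto simp: value_le_def\<close>)

lemma totally_ordered_value_group: "totally_ordered_comm_group \<Gamma> (value_le K R)"
proof -
  interpret G: comm_group \<Gamma> by (rule comm_group_value_group)
  show ?thesis
  proof
    have "value_le K R \<subseteq> carrier \<Gamma> \<times> carrier \<Gamma>"
      by (auto simp: value_le_def)
    moreover have "refl_on (carrier \<Gamma>) (value_le K R)"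
      by (auto simp: refl_on_def carrier_value_group cls_le_iff one_mem)
    moreover have "trans (value_le K R)"
      unfolding trans_def
    proof (intro allI impI)
      fix a b c assume ab: "(a, b) \<in> value_le K R" and bc: "(b, c) \<in> value_le K R"
      then obtain x y z where "a = cls x" "b = cls y" "c = cls z"
        "x \<in> Units K" "y \<in> Units K" "z \<in> Units K"
        by (auto simp: value_le_def)
      with ab bc quotient_mem_trans[of x y z] show "(a, c) \<in> value_le K R"
        by (simp add: cls_le_iff)
    qed
    moreover have "antisym (value_le K R)"
      unfolding antisym_def
    proof (intro allI impI)
      fix a b assume ab: "(a, b) \<in> value_le K R" and ba: "(b, a) \<in> value_le K R"
      then obtain x y where "a = cls x" "b = cls y" "x \<in> Units K" "y \<in> Units K"
        by (auto simp: value_le_def)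
      with ab ba show "a = b" by (simp add: cls_le_iff cls_eq_iff)
    qed
    moreover have "total_on (carrier \<Gamma>) (value_le K R)"
      using quotient_total by (auto simp: total_on_def carrier_value_group cls_le_iff)
    ultimately show "linear_order_on (carrier \<Gamma>) (value_le K R)"
      by (simp add: linear_order_on_def partial_order_on_def preorder_on_def)
  next
    fix a b c assume ab: "(a, b) \<in> value_le K R" and "c \<in> carrier \<Gamma>"
    then obtain x y z where *: "a = cls x" "b = cls y" "c = cls z"
      "x \<in> Units K" "y \<in> Units K" "z \<in> Units K"
      by (auto simp: value_le_def carrier_value_group)
    have "(x \<otimes> z) \<otimes> inv (y \<otimes> z) = (x \<otimes> z) \<otimes> (inv z \<otimes> inv y)"
      using * by (simp add: inv_mult_Units)
    \<comment> \<open>Telescoping through \<open>inv z\<close>, whose inverse is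
      \<open>z\<close>.\<close>
    also have "\<dots> = x \<otimes> inv y"
      using * quotient_mult[of x "inv z" y] by simp
    finally show "(a \<otimes>\<^bsub>\<Gamma>\<^esub> c, b \<otimes>\<^bsub>\<Gamma>\<^esub> c) \<in> value_le K R"
      using * ab by (simp add: cls_mult cls_le_iff)
  qed
qed

section \<open>Upper bounds of finite sums in the value semifield\<close>

sublocale VG: totally_ordered_comm_group "\<Gamma>" "value_le K R"
  by (rule totally_ordered_value_group)

sublocale VS: abelian_monoid "V"
  unfolding value_semifield_def by (rule VG.abelian_monoid_max_semifield)

lemma Some_cls_closed [simp]: "u \<in> Units K \<Longrightarrow> Some (cls u) \<in> carrier V"
  by (simp add: value_semifield_def)

text \<open>The canonical order of \<open>V\<close>, which is defined through addition, restricts to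
  \<open>value_le\<close> on nonzero elements.\<close>

lemma Some_cls_le_iff:
  assumes "x \<in> Units K" "y \<in> Units K"
  shows "canonical_le V (Some (cls x)) (Some (cls y)) \<longleftrightarrow> x \<otimes> inv y \<in> R"
  using assms by (auto simp: canonical_le_def value_semifield_def cls_eq_iff cls_le_iff)

text \<open>Induction on \<open>I\<close>. In \<open>V\<close>, a bound on a sum is a bound on each
  summand; in \<open>K\<close>, a sum lies in \<open>R\<close> exactly when each summand does; for a
  single unit the two conditions agree. Hence the bounds of the sum of classes depend only on the
  sum of the units.\<close>

lemma value_sum_le_iff:
  assumes "finite I" "a \<in> I \<rightarrow> Units K" and u: "u \<in> Units K"
  shows "canonical_le V (\<Oplus>\<^bsub>V\<^esub>i\<in>I. Some (cls (a i))) (Some (cls u)) \<longleftrightarrow> finsum K a I \<otimes> inv u \<in> R"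
  using assms(1,2)
proof (induction I rule: finite_induct)
  case empty
  \<comment> \<open>The empty sums are \<open>None\<close>, which lies below everything, and
    \<zero>, which lies in \<open>R\<close>.\<close>
  then show ?case
    using u zero_mem by (simp add: canonical_le_def)
next
  case (insert i I)
  then have a: "a i \<in> Units K" "a \<in> I \<rightarrow> carrier K" and s: "finsum K a I \<in> carrier K"
    by (auto intro!: finsum_closed)
  have V: "(\<lambda>i. Some (cls (a i))) \<in> I \<rightarrow> carrier V"
    using insert.prems by (intro Pi_I Some_cls_closed) auto
  from insert.prems insert.IH
  have IH: "canonical_le V (\<Oplus>\<^bsub>V\<^esub>i\<in>I. Some (cls (a i))) (Some (cls u)) \<longleftrightarrow> finsum K a I \<otimes> inv u \<in> R"
    by simp
  have "canonical_le V (\<Oplus>\<^bsub>V\<^esub>i\<in>insert i I. Some (cls (a i))) (Some (cls u))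
    \<longleftrightarrow> canonical_le V (Some (cls (a i))) (Some (cls u)) \<and> finsum K a I \<otimes> inv u \<in> R"
    using insert.hyps V a u VG.max_semifield_add_le_iff[folded value_semifield_def] IH
    by (simp add: VS.finsum_insert)
  also have "\<dots> \<longleftrightarrow> a i \<otimes> inv u \<oplus> finsum K a I \<otimes> inv u \<in> R"
    using a s u by (simp add: Some_cls_le_iff add_mem_iff Units_closed)
  also have "\<dots> \<longleftrightarrow> finsum K a (insert i I) \<otimes> inv u \<in> R"
    using insert.hyps a s u by (simp add: finsum_insert l_distr Units_closed)
  finally show ?case .
qed

text \<open>Both sides hold exactly for empty \<open>I\<close>: a nonempty maximum of classes is a
  class, and a nonzero summand keeps a sum in \<open>K\<close> from vanishing.\<close>

lemma value_sum_None_iff: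
  assumes "finite I" "a \<in> I \<rightarrow> Units K"
  shows "(\<Oplus>\<^bsub>V\<^esub>i\<in>I. Some (cls (a i))) = None \<longleftrightarrow> finsum K a I = \<zero>"
  using assms
proof (induction I rule: finite_induct)
  case empty
  show ?case by simp (simp add: value_semifield_def)
next
  case (insert i I)
  then have a: "a i \<in> Units K" "a \<in> I \<rightarrow> carrier K" by auto
  have V: "(\<lambda>i. Some (cls (a i))) \<in> I \<rightarrow> carrier V"
    using insert.prems by (intro Pi_I Some_cls_closed) auto
  have "(\<Oplus>\<^bsub>V\<^esub>i\<in>insert i I. Some (cls (a i))) \<noteq> None"
    using insert.hyps V a
    by (cases "\<Oplus>\<^bsub>V\<^esub>i\<in>I. Some (cls (a i))") (auto simp: VS.finsum_insert, auto simp: value_semifield_def)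
  moreover have "finsum K a (insert i I) \<noteq> \<zero>"
    using insert.hyps a Units_nonzero by (auto simp: finsum_insert add_eq_zero_iff Units_closed)
  ultimately show ?case by simp
qed

lemma value_sum_closed:
  "a \<in> I \<rightarrow> Units K \<Longrightarrow> (\<Oplus>\<^bsub>V\<^esub>i\<in>I. Some (cls (a i))) \<in> carrier V"
  by (intro VS.finsum_closed) (auto intro!: Some_cls_closed)

(* The hypothesis on None is needed when the value group is trivial: then zero and one have the
   same upper bounds among the nonzero values. *)
lemma value_ext:
  assumes "s \<in> carrier V" "t \<in> carrier V" "s = None \<longleftrightarrow> t = None"
    and le_iff: "\<And>u. u \<in> Units K \<Longrightarrow>
      canonical_le V s (Some (cls u)) \<longleftrightarrow> canonical_le V t (Some (cls u))"
  shows "s = t"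
proof (cases s)
  case (Some g)
  with assms obtain x y where *: "s = Some (cls x)" "t = Some (cls y)" "x \<in> Units K" "y \<in> Units K"
    by (auto simp: value_semifield_def carrier_value_group)
  with le_iff[of x] le_iff[of y] show ?thesis
    by (simp add: Some_cls_le_iff cls_eq_iff one_mem)
qed (use assms in simp)

text \<open>Two presentations of one element give sums of classes that vanish together and have the
  same upper bounds among the classes, which determines an element of \<open>V\<close>. This makes
  \<open>valuation_map\<close> well defined.\<close>

lemma value_sum_eqI:
  assumes "finite I" "a \<in> I \<rightarrow> Units K" "finite J" "b \<in> J \<rightarrow> Units K" "finsum K a I = finsum K b J"
  shows "(\<Oplus>\<^bsub>V\<^esub>i\<in>I. Some (cls (a i))) = (\<Oplus>\<^bsub>V\<^esub>j\<in>J. Some (cls (b j)))"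
  using assms by (intro value_ext value_sum_closed) (auto simp: value_sum_None_iff value_sum_le_iff)

section \<open>The valuation on sums of units\<close>

lemma valuation_map_finsum:
  fixes I :: "'i set"
  assumes gen: "unitgenerated K" and I: "finite I" "a \<in> I \<rightarrow> Units K"
  shows "valuation_map K R (finsum K a I) = (\<Oplus>\<^bsub>V\<^esub>i\<in>I. Some (cls (a i)))"
proof -
  have "finsum K a I \<in> carrier K" using I by (intro finsum_closed) auto
  \<comment> \<open>\<open>valuation_map\<close> is described by presentations indexed by natural
    numbers, whereas \<open>I\<close> has an arbitrary index type. Unit generation supplies such a
    presentation of the same element.\<close>
  with gen obtain J :: "nat set" and b where
    J: "finite J" "b \<in> J \<rightarrow> Units K" "finsum K a I = finsum K b J"
    unfolding unitgenerated_def by blast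
  show ?thesis
    unfolding valuation_map_def
  proof (rule the_equality)
    show "\<exists>(J :: nat set) b. finite J \<and> b \<in> J \<rightarrow> Units K \<and> finsum K a I = finsum K b J \<and>
      (\<Oplus>\<^bsub>V\<^esub>i\<in>I. Some (cls (a i))) = (\<Oplus>\<^bsub>V\<^esub>j\<in>J. Some (cls (b j)))"
      using J value_sum_eqI[OF I J] by blast
  next
    fix g
    assume "\<exists>(J :: nat set) b. finite J \<and> b \<in> J \<rightarrow> Units K \<and> finsum K a I = finsum K b J \<and>
      g = (\<Oplus>\<^bsub>V\<^esub>j\<in>J. Some (cls (b j)))"
    then show "g = (\<Oplus>\<^bsub>V\<^esub>i\<in>I. Some (cls (a i)))"
      using value_sum_eqI[OF I] by metis
  qed
qed

lemma valuation_map_closed: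
  assumes "unitgenerated K" "x \<in> carrier K"
  shows "valuation_map K R x \<in> carrier V"
proof -
  from assms obtain I :: "nat set" and a where "finite I" "a \<in> I \<rightarrow> Units K" "x = finsum K a I"
    unfolding unitgenerated_def by blast
  then show ?thesis
    using valuation_map_finsum[OF assms(1)] value_sum_closed by metis
qed

lemma valuation_map_le_one_iff:
  assumes "unitgenerated K" "x \<in> carrier K"
  shows "canonical_le V (valuation_map K R x) \<one>\<^bsub>V\<^esub> \<longleftrightarrow> x \<in> R"
proof -
  from assms obtain I :: "nat set" and a where *: "finite I" "a \<in> I \<rightarrow> Units K" "x = finsum K a I"
    unfolding unitgenerated_def by blast
  \<comment> \<open>Seeing the one of \<open>V\<close> as a class allows the upper bound criterion
    to be used with test unit \<one>.\<close>
  moreover have "\<one>\<^bsub>V\<^esub> = Some (cls \<one>)"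
    by (simp add: value_semifield_def cls_one)
  ultimately show ?thesis
    using value_sum_le_iff[of I a \<one>] valuation_map_finsum[OF assms(1), of I a] assms(2) by simp
qed

end

text \<open>The conjuncts before the last give its terms their meaning: the order must not depend on
  representatives, and \<open>valuation_map\<close> must be a genuine value of its definite
  description, for families over any index type.\<close>

theorem theorem3p8:
  fixes K :: "('a, 'm) ring_scheme" and R :: "'a set"
  assumes "idempotent_semiring K"
    and "unitgenerated K"
    and "valuation_subsemiring R K"
  shows "totally_ordered_comm_group (value_group K R) (value_le K R)
    \<and> (\<forall>x\<in>Units K. \<forall>y\<in>Units K.
          (unit_class K R x, unit_class K R y) \<in> value_le K R \<longleftrightarrow> x \<otimes>\<^bsub>K\<^esub> inv\<^bsub>K\<^esub> y \<in> R)
    \<and> valuation_map K R \<in> carrier K \<rightarrow> carrier (value_semifield K R)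
    \<and> (\<forall>(I :: 'i set) a. finite I \<and> a \<in> I \<rightarrow> Units K \<longrightarrow>
          valuation_map K R (\<Oplus>\<^bsub>K\<^esub>i\<in>I. a i)
            = (\<Oplus>\<^bsub>value_semifield K R\<^esub>i\<in>I. Some (unit_class K R (a i))))
    \<and> R = {x \<in> carrier K.
          canonical_le (value_semifield K R) (valuation_map K R x) \<one>\<^bsub>value_semifield K R\<^esub>}"
proof -
  interpret valued_semiring K R
    using assms(1,3) by (rule valued_semiring.intro)
  have "R = {x \<in> carrier K. canonical_le V (valuation_map K R x) \<one>\<^bsub>V\<^esub>}"
    using subset valuation_map_le_one_iff[OF assms(2)] by blast
  then show ?thesis
    using totally_ordered_value_group cls_le_iff valuation_map_closed[OF assms(2)]
      valuation_map_finsum[OF assms(2)]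
    by (intro conjI) auto
qed

end
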